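(* Let $X$ be a quandle, and let $O \subset X$ be a connected component of $X$. Then the following hold: (1) For any finite generating sets $A, B$ of the group $\mathrm{Inn}(X)$, the identity map $\mathrm{id}|_{O}\colon (O, d^{\mathrm{Inn}}_{A}) \to (O, d^{\mathrm{Inn}}_{B})$ is a quasi-isometry. (2) For any finite generating sets $U, V$ of the group $\mathrm{Dis}(X)$, the identity map $\mathrm{id}|_{O}\colon (O, d^{\mathrm{Dis}}_{U}) \to (O, d^{\mathrm{Dis}}_{V})$ is a quasi-isometry.
   Context: A quandle is a non-empty set $X$ with a binary operation $\triangleleft$ such that (i) $x \triangleleft x = x$ for all $x$; (ii) for every $y \in X$ the map $s_y \colon X \to X$, $s_y(x) = x \triangleleft y$, is a bijection (the point symmetry at $y$); (iii) $(x \triangleleft y)\triangleleft z = (x \triangleleft z)\triangleleft (y \triangleleft z)$ for all $x,y,z$. $\mathrm{Aut}(X)$ is the group of bijective quandle homomorphisms $X\to X$ with product $fg := g \circ f$; it acts on $X$ from the right by $x\cdot f := f(x)$. $\mathrm{Inn}(X)$ is the subgroup of $\mathrm{Aut}(X)$ generated by $\{s_y \mid y \in X\}$, and $\mathrm{Dis}(X)$ is the subgroup generated by $\{s_x s_y^{-1} \mid x,y\in X\}$. A connected component of $X$ is an orbit of $\mathrm{Inn}(X)$; the orbits of $\mathrm{Dis}(X)$ on $X$ are the same sets. For a group $G$ acting on $X$ from the right and a generating set $S$ of $G$, the Schreier graph $\Gamma(X,G,S)$ is the undirected graph with vertex set $X$ in which $x,y$ are joined by an edge if $y = x\cdot s$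 for some $s \in S\cup S^{-1}$. Its connected components are the $G$-orbits, and each carries the path metric (edges have length one). For a generating set $A$ of $\mathrm{Inn}(X)$, the inner metric $d^{\mathrm{Inn}}_A$ on a connected component is the path metric of $\Gamma(X,\mathrm{Inn}(X),A)$; for a generating set $U$ of $\mathrm{Dis}(X)$, the displacement metric $d^{\mathrm{Dis}}_U$ is the path metric of $\Gamma(X,\mathrm{Dis}(X),U)$. *)

theory Defs
  imports
    "HOL-Algebra.Group_Action"
    "HOL-Algebra.Generated_Groups"
    "HOL-Analysis.Abstract_Metric_Spaces"
    "Graph_Theory.Shortest_Path"
    "Graph_Theory.Pair_Digraph"
begin

section \<open>Quandles and their groups\<close>

locale quandle =
  fixes X :: "'a set" and q :: "'a \<Rightarrow> 'a \<Rightarrow> 'a"  (infixl \<open>\<triangleleft>\<close> 70)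
  assumes nonempty: "X \<noteq> {}"
    and closed: "x \<in> X \<Longrightarrow> y \<in> X \<Longrightarrow> x \<triangleleft> y \<in> X"
    and idem: "x \<in> X \<Longrightarrow> x \<triangleleft> x = x"
    and bij: "y \<in> X \<Longrightarrow> bij_betw (\<lambda>x. x \<triangleleft> y) X X"
    and distrib: "x \<in> X \<Longrightarrow> y \<in> X \<Longrightarrow> z \<in> X \<Longrightarrow>
      (x \<triangleleft> y) \<triangleleft> z = (x \<triangleleft> z) \<triangleleft> (y \<triangleleft> z)"

definition point_symmetry :: "'a set \<Rightarrow> ('a \<Rightarrow> 'a \<Rightarrow> 'a) \<Rightarrow> 'a \<Rightarrow> 'a \<Rightarrow> 'a" where
  "point_symmetry X q y = (\<lambda>x\<in>X. q x y)"

text \<open>The product is \<open>f g := g \<circ> f\<close>, opposite to the one of \<^const>\<open>BijGroup\<close>, so that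
  \<open>x \<cdot> f := f x\<close> is a right action.\<close>

definition quandle_Aut :: "'a set \<Rightarrow> ('a \<Rightarrow> 'a \<Rightarrow> 'a) \<Rightarrow> ('a \<Rightarrow> 'a) monoid" where
  "quandle_Aut X q =
    \<lparr>carrier = {f \<in> Bij X. \<forall>x\<in>X. \<forall>y\<in>X. f (q x y) = q (f x) (f y)},
     monoid.mult = (\<lambda>f g. compose X g f),
     monoid.one = (\<lambda>x\<in>X. x)\<rparr>"

definition quandle_Inn :: "'a set \<Rightarrow> ('a \<Rightarrow> 'a \<Rightarrow> 'a) \<Rightarrow> ('a \<Rightarrow> 'a) monoid" where
  "quandle_Inn X q = (quandle_Aut X q)
    \<lparr>carrier := generate (quandle_Aut X q) {point_symmetry X q y | y. y \<in> X}\<rparr>"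

definition quandle_Dis :: "'a set \<Rightarrow> ('a \<Rightarrow> 'a \<Rightarrow> 'a) \<Rightarrow> ('a \<Rightarrow> 'a) monoid" where
  "quandle_Dis X q = (quandle_Aut X q)
    \<lparr>carrier := generate (quandle_Aut X q)
       {point_symmetry X q x \<otimes>\<^bsub>quandle_Aut X q\<^esub> inv\<^bsub>quandle_Aut X q\<^esub> (point_symmetry X q y)
        | x y. x \<in> X \<and> y \<in> X}\<rparr>"

definition quandle_components :: "'a set \<Rightarrow> ('a \<Rightarrow> 'a \<Rightarrow> 'a) \<Rightarrow> 'a set set" where
  "quandle_components X q = orbits (quandle_Inn X q) X (\<lambda>f x. f x)"


section \<open>Schreier graphs and path metrics\<close>

definition generating_set :: "('g, 'b) monoid_scheme \<Rightarrow> 'g set \<Rightarrow> bool" where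
  "generating_set G S \<longleftrightarrow> S \<subseteq> carrier G \<and> generate G S = carrier G"

text \<open>Undirected graphs are symmetric digraphs here; \<open>act x s\<close> is \<open>x \<cdot> s\<close>.\<close>

definition schreier_graph ::
  "'x set \<Rightarrow> ('g, 'b) monoid_scheme \<Rightarrow> ('x \<Rightarrow> 'g \<Rightarrow> 'x) \<Rightarrow> 'g set \<Rightarrow> 'x pair_pre_digraph" where
  "schreier_graph X G act S =
    \<lparr>pverts = X,
     parcs = {(x, y). x \<in> X \<and> y \<in> X \<and> (\<exists>s \<in> S \<union> m_inv G ` S. y = act x s)}\<rparr>"

text \<open>The length of a shortest walk. Between different components the infimum is \<open>\<infinity>\<close>, which
  \<^const>\<open>real_of_ereal\<close> sends to \<open>0\<close>, so this is meaningful within one component only.\<close>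

definition path_dist :: "'x pair_pre_digraph \<Rightarrow> 'x \<Rightarrow> 'x \<Rightarrow> real" where
  "path_dist \<Gamma> x y = real_of_ereal (wf_digraph.\<mu> (with_proj \<Gamma>) (\<lambda>_. 1) x y)"

definition path_metric :: "'x pair_pre_digraph \<Rightarrow> 'x set \<Rightarrow> 'x metric" where
  "path_metric \<Gamma> C = metric (C, path_dist \<Gamma>)"

text \<open>Sanity check: on a set of mutually reachable vertices of a symmetric graph, \<^const>\<open>path_dist\<close>
  is a metric, so that \<^const>\<open>path_metric\<close> carries the intended data.\<close>

lemma (in wf_digraph) awalk_cost_length: "awalk_cost (\<lambda>_. 1) p = real (length p)"
  by (induction p) auto

lemma (in wf_digraph) reachable_mu:
  assumes "u \<rightarrow>\<^sup>* v"
  obtains p where "awalk u p v" "\<mu> (\<lambda>_. 1) u v = ereal (real (length p))"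
    "\<And>p'. awalk u p' v \<Longrightarrow> length p \<le> length p'"
proof -
  obtain p0 where "awalk u p0 v"
    using assms by (auto simp: reachable_awalk)
  then obtain p where p: "awalk u p v" and min: "\<And>p'. awalk u p' v \<Longrightarrow> length p \<le> length p'"
    using ex_has_least_nat[of "\<lambda>p. awalk u p v" p0 length] by blast
  have "\<mu> (\<lambda>_. 1) u v = ereal (real (length p))"
    unfolding \<mu>_def awalk_cost_length using p min
    by (intro antisym INF_lower2[of p] INF_greatest) auto
  with p min show ?thesis using that by blast
qed

lemma (in pair_wf_digraph) Metric_space_path_dist:
  assumes sym: "sym (parcs G)"
    and conn: "\<And>x y. x \<in> C \<Longrightarrow> y \<in> C \<Longrightarrow> x \<rightarrow>\<^sup>*\<^bsub>with_proj G\<^esub> y"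
  shows "Metric_space C (path_dist G)"
proof -
  have rev: "\<exists>p'. awalk y p' x \<and> length p' = length p" if "awalk x p y" for x y p
    using that
  proof (induction p arbitrary: x)
    case Nil
    then show ?case by (auto simp: awalk_Nil_iff)
  next
    case (Cons e p)
    obtain a b where e: "e = (a, b)" by (cases e)
    have w: "e \<in> parcs G" "x = a" "awalk b p y"
      using Cons.prems e by (auto simp: awalk_Cons_iff)
    obtain p' where p': "awalk y p' b" "length p' = length p"
      using Cons.IH w by blast
    have "(b, a) \<in> parcs G"
      using sym w e by (auto dest: symD)
    then have "awalk b [(b, a)] a"
      using arc_implies_awalk[of "(b, a)"] by simp
    then have "awalk y (p' @ [(b, a)]) x"
      using p' w by (auto intro: awalk_appendI)
    then show ?case using p' by (metis length_append_singleton length_Cons)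
  qed
  have le: "\<mu> (\<lambda>_. 1) y x \<le> \<mu> (\<lambda>_. 1) x y" for x y
    unfolding \<mu>_def awalk_cost_length
  proof (rule INF_mono)
    fix p assume "p \<in> {p. awalk x p y}"
    then obtain p' where "awalk y p' x" "length p' = length p"
      using rev by blast
    then show "\<exists>p'\<in>{p. awalk y p x}. ereal (real (length p')) \<le> ereal (real (length p))"
      by (intro bexI[of _ p']) simp_all
  qed
  have nn: "0 \<le> \<mu> (\<lambda>_. 1) x y" for x y
    unfolding \<mu>_def awalk_cost_length by (auto intro: INF_greatest)
  show ?thesis
  proof
    fix x y
    show "0 \<le> path_dist G x y"
      unfolding path_dist_def using nn by (simp add: real_of_ereal_pos)
    show "path_dist G x y = path_dist G y x"
      unfolding path_dist_def by (simp add: antisym[OF le[of x y] le[of y x]])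
  next
    fix x y assume xy: "x \<in> C" "y \<in> C"
    obtain p where p: "awalk x p y" "\<mu> (\<lambda>_. 1) x y = ereal (real (length p))"
      "\<And>p'. awalk x p' y \<Longrightarrow> length p \<le> length p'"
      using reachable_mu[OF conn[OF xy]] by blast
    show "path_dist G x y = 0 \<longleftrightarrow> x = y"
    proof
      assume "path_dist G x y = 0"
      then show "x = y" using p by (auto simp: path_dist_def awalk_Nil_iff)
    next
      assume "x = y"
      then have "awalk x [] y" using p(1) by (auto simp: awalk_Nil_iff)
      from p(3)[OF this] show "path_dist G x y = 0" using p(2) by (simp add: path_dist_def)
    qed
  next
    fix x y z assume C: "x \<in> C" "y \<in> C" "z \<in> C"
    obtain p where p: "awalk x p y" "\<mu> (\<lambda>_. 1) x y = ereal (real (length p))"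
      using reachable_mu[OF conn[OF C(1,2)]] by blast
    obtain r where r: "awalk y r z" "\<mu> (\<lambda>_. 1) y z = ereal (real (length r))"
      using reachable_mu[OF conn[OF C(2,3)]] by blast
    obtain s where s: "awalk x s z" "\<mu> (\<lambda>_. 1) x z = ereal (real (length s))"
      "\<And>p'. awalk x p' z \<Longrightarrow> length s \<le> length p'"
      using reachable_mu[OF conn[OF C(1,3)]] by blast
    have "awalk x (p @ r) z" using p(1) r(1) by (rule awalk_appendI)
    from s(3)[OF this] show "path_dist G x z \<le> path_dist G x y + path_dist G y z"
      using p(2) r(2) s(2) by (simp add: path_dist_def)
  qed
qed

definition inner_metric ::
  "'a set \<Rightarrow> ('a \<Rightarrow> 'a \<Rightarrow> 'a) \<Rightarrow> ('a \<Rightarrow> 'a) set \<Rightarrow> 'a set \<Rightarrow> 'a metric" where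
  "inner_metric X q A C =
    path_metric (schreier_graph X (quandle_Inn X q) (\<lambda>x f. f x) A) C"

definition displacement_metric ::
  "'a set \<Rightarrow> ('a \<Rightarrow> 'a \<Rightarrow> 'a) \<Rightarrow> ('a \<Rightarrow> 'a) set \<Rightarrow> 'a set \<Rightarrow> 'a metric" where
  "displacement_metric X q U C =
    path_metric (schreier_graph X (quandle_Dis X q) (\<lambda>x f. f x) U) C"


section \<open>Quasi-isometries\<close>

definition quasi_isometry :: "'a metric \<Rightarrow> 'b metric \<Rightarrow> ('a \<Rightarrow> 'b) \<Rightarrow> bool" where
  "quasi_isometry m1 m2 f \<longleftrightarrow> f \<in> mspace m1 \<rightarrow> mspace m2 \<and>
    (\<exists>K L. K \<ge> 1 \<and> L \<ge> 0 \<and>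
      (\<forall>x \<in> mspace m1. \<forall>y \<in> mspace m1.
        mdist m1 x y / K - L \<le> mdist m2 (f x) (f y) \<and>
        mdist m2 (f x) (f y) \<le> K * mdist m1 x y + L) \<and>
      (\<forall>z \<in> mspace m2. \<exists>x \<in> mspace m1. mdist m2 (f x) z \<le> L))"

end

theory Submission
  imports Defs
begin

text \<open>Changing a finite generating set of a group \<open>G\<close> that acts on \<open>X\<close> distorts the path metrics of
  the Schreier graphs only by a bounded factor. Each of the finitely many elements of
  \<open>A \<union> A\<inverse>\<close> is a word in \<open>B\<close>, and a single word, read off from an arbitrary starting vertex, gives
  a walk of the same length. Hence there is one constant \<open>n\<close> such that every edge of the graph of
  \<open>A\<close> can be replaced by a walk of length at most \<open>n\<close> in the graph of \<open>B\<close>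
  (\<open>ex_schreier_path_dist_bound\<close>). By symmetry the identity is bi-Lipschitz on every subset of a
  \<open>G\<close>-orbit (\<open>quasi_isometry_schreier\<close>); transitivity is what makes the two distances finite, and
  so genuine metrics.

  Both parts are instances of this, for the groups \<open>Inn\<close> and \<open>Dis\<close>. A component is by definition an
  orbit of \<open>Inn\<close>; that \<open>Dis\<close> has the same orbits (\<open>Dis_orbit_if_Inn\<close>) comes from idempotence:
  as \<open>s\<^sub>x\<close> fixes \<open>x\<close>, the displacement \<open>s\<^sub>x s\<^sub>y\<inverse>\<close> moves \<open>x\<close> exactly as \<open>s\<^sub>y\<inverse>\<close> does.\<close>

section \<open>Walks and path distances\<close>

context pair_wf_digraph
begin

lemma path_dist_le_length:
  assumes "awalk x p y"
  shows "path_dist G x y \<le> real (length p)"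
proof -
  have "x \<rightarrow>\<^sup>*\<^bsub>with_proj G\<^esub> y"
    using assms by (auto simp: reachable_awalk)
  then obtain r where "awalk x r y" "\<mu> (\<lambda>_. 1) x y = ereal (real (length r))"
    "\<And>p'. awalk x p' y \<Longrightarrow> length r \<le> length p'"
    by (rule reachable_mu) blast
  with assms show ?thesis by (simp add: path_dist_def)
qed

lemma ex_shortest_awalk:
  assumes "x \<rightarrow>\<^sup>*\<^bsub>with_proj G\<^esub> y"
  obtains p where "awalk x p y" "path_dist G x y = real (length p)"
  using reachable_mu[OF assms] by (metis path_dist_def real_of_ereal.simps(1))

text \<open>Concatenating the walks that replace the individual arcs is what turns a bound for single
  generators into a Lipschitz bound for path distances.\<close>

lemma awalk_substitute:
  assumes H: "pair_wf_digraph H" and verts: "pverts G \<subseteq> pverts H"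
    and arcs: "\<And>u v. (u, v) \<in> parcs G \<Longrightarrow> \<exists>r. pre_digraph.awalk (with_proj H) u r v \<and> length r \<le> n"
    and p: "awalk x p y"
  shows "\<exists>r. pre_digraph.awalk (with_proj H) x r y \<and> length r \<le> n * length p"
proof -
  interpret H: pair_wf_digraph H by (rule H)
  show ?thesis
    using p
  proof (induction p arbitrary: x)
    case Nil
    then show ?case using verts by (auto simp: awalk_Nil_iff H.awalk_Nil_iff)
  next
    case (Cons e p)
    obtain v where e: "e = (x, v)" "(x, v) \<in> parcs G" "awalk v p y"
      using Cons.prems by (cases e) (auto simp: awalk_Cons_iff)
    obtain r where r: "H.awalk x r v" "length r \<le> n" using arcs e(2) by blast
    obtain r' where r': "H.awalk v r' y" "length r' \<le> n * length p" using Cons.IH e(3) by blast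
    have "H.awalk x (r @ r') y" using r(1) r'(1) by (rule H.awalk_appendI)
    with r(2) r'(2) show ?case by (intro exI[of _ "r @ r'"]) simp
  qed
qed

end


section \<open>Schreier graphs of right actions\<close>

locale right_action = group G
  for G :: "('g, 'b) monoid_scheme" (structure) +
  fixes X :: "'x set" and act :: "'x \<Rightarrow> 'g \<Rightarrow> 'x"
  assumes act_closed: "x \<in> X \<Longrightarrow> g \<in> carrier G \<Longrightarrow> act x g \<in> X"
    and act_one: "x \<in> X \<Longrightarrow> act x \<one> = x"
    and act_mult: "x \<in> X \<Longrightarrow> g \<in> carrier G \<Longrightarrow> h \<in> carrier G \<Longrightarrow>
      act x (g \<otimes> h) = act (act x g) h"
begin

lemma act_inv_act:
  assumes "x \<in> X" "g \<in> carrier G"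
  shows "act (act x g) (inv g) = x"
  using assms act_mult[of x g "inv g"] by (simp add: act_one)

lemma pair_wf_digraph_schreier: "pair_wf_digraph (schreier_graph X G act S)"
  by unfold_locales (auto simp: schreier_graph_def)

lemma pverts_schreier: "pverts (schreier_graph X G act S) = X"
  by (simp add: schreier_graph_def)

lemma schreier_arcI:
  assumes "x \<in> X" "S \<subseteq> carrier G" "s \<in> S \<union> m_inv G ` S"
  shows "(x, act x s) \<in> parcs (schreier_graph X G act S)"
  using assms by (auto simp: schreier_graph_def intro!: act_closed)

lemma sym_schreier_arcs:
  assumes "S \<subseteq> carrier G"
  shows "sym (parcs (schreier_graph X G act S))"
proof (rule symI)
  fix x y assume "(x, y) \<in> parcs (schreier_graph X G act S)"
  then obtain s where s: "x \<in> X" "y \<in> X" "s \<in> S \<union> m_inv G ` S" "y = act x s"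
    by (auto simp: schreier_graph_def)
  have "s \<in> carrier G" using s(3) assms by auto
  then have "x = act y (inv s)" using s by (simp add: act_inv_act)
  moreover have "inv s \<in> S \<union> m_inv G ` S" using s(3) assms by auto
  ultimately show "(y, x) \<in> parcs (schreier_graph X G act S)"
    using s by (auto simp: schreier_graph_def)
qed

text \<open>The bound does not depend on the vertex \<open>x\<close>: the same word in the generators represents
  \<open>g\<close> wherever the walk starts.\<close>

lemma ex_uniform_awalk_bound:
  assumes S: "S \<subseteq> carrier G" and g: "g \<in> generate G S"
  shows "\<exists>n. \<forall>x\<in>X. \<exists>p.
    pre_digraph.awalk (with_proj (schreier_graph X G act S)) x p (act x g) \<and> length p \<le> n"
proof -
  interpret pair_wf_digraph "schreier_graph X G act S" by (rule pair_wf_digraph_schreier)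
  have edge: "\<exists>n. \<forall>x\<in>X. \<exists>p. awalk x p (act x s) \<and> length p \<le> n"
    if "s \<in> S \<union> m_inv G ` S" for s
  proof (intro exI[of _ 1] ballI)
    fix x assume "x \<in> X"
    then have "awalk x [(x, act x s)] (act x s)"
      using arc_implies_awalk[of "(x, act x s)"] schreier_arcI[OF _ S that] by simp
    then show "\<exists>p. awalk x p (act x s) \<and> length p \<le> 1"
      by (intro exI[of _ "[(x, act x s)]"]) simp
  qed
  show ?thesis
    using g
  proof (induction rule: generate.induct)
    case one
    show ?case
      by (intro exI[of _ 0]) (auto simp: act_one awalk_Nil_iff pverts_schreier)
  next
    case (incl s)
    then show ?case using edge by blast
  next
    case (inv s)
    then show ?case using edge by blast
  next
    case (eng g h)
    obtain m where m: "\<And>x. x \<in> X \<Longrightarrow> \<exists>p. awalk x p (act x g) \<and> length p \<le> m"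
      using eng.IH by blast
    obtain n where n: "\<And>x. x \<in> X \<Longrightarrow> \<exists>p. awalk x p (act x h) \<and> length p \<le> n"
      using eng.IH by blast
    have carr: "g \<in> carrier G" "h \<in> carrier G"
      using eng.hyps generate_in_carrier[OF S] by auto
    show ?case
    proof (intro exI[of _ "m + n"] ballI)
      fix x assume x: "x \<in> X"
      obtain p where p: "awalk x p (act x g)" "length p \<le> m" using m[OF x] by blast
      obtain r where r: "awalk (act x g) r (act (act x g) h)" "length r \<le> n"
        using n[OF act_closed[OF x carr(1)]] by blast
      have "awalk x (p @ r) (act x (g \<otimes> h))"
        using awalk_appendI[OF p(1) r(1)] act_mult[OF x carr] by simp
      then show "\<exists>p. awalk x p (act x (g \<otimes> h)) \<and> length p \<le> m + n"
        using p(2) r(2) by (intro exI[of _ "p @ r"]) simp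
    qed
  qed
qed

lemma schreier_reachable:
  assumes "generating_set G S" "x \<in> X" "g \<in> carrier G"
  shows "x \<rightarrow>\<^sup>*\<^bsub>with_proj (schreier_graph X G act S)\<^esub> act x g"
proof -
  interpret pair_wf_digraph "schreier_graph X G act S" by (rule pair_wf_digraph_schreier)
  show ?thesis
    using ex_uniform_awalk_bound[of S g] assms
    by (auto simp: generating_set_def reachable_awalk)
qed

lemma Metric_space_schreier:
  assumes S: "generating_set G S" and "C \<subseteq> X"
    and trans: "\<And>x y. x \<in> C \<Longrightarrow> y \<in> C \<Longrightarrow> \<exists>g\<in>carrier G. y = act x g"
  shows "Metric_space C (path_dist (schreier_graph X G act S))"
proof (rule pair_wf_digraph.Metric_space_path_dist[OF pair_wf_digraph_schreier])
  show "sym (parcs (schreier_graph X G act S))"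
    using S sym_schreier_arcs by (simp add: generating_set_def)
  show "x \<rightarrow>\<^sup>*\<^bsub>with_proj (schreier_graph X G act S)\<^esub> y" if "x \<in> C" "y \<in> C" for x y
    using trans[OF that] schreier_reachable[OF S] that \<open>C \<subseteq> X\<close> by blast
qed

lemma ex_schreier_path_dist_bound:
  assumes A: "finite A" "generating_set G A" and B: "generating_set G B"
  shows "\<exists>n::nat. \<forall>x\<in>X. \<forall>g\<in>carrier G.
    path_dist (schreier_graph X G act B) x (act x g)
      \<le> n * path_dist (schreier_graph X G act A) x (act x g)"
proof -
  interpret A: pair_wf_digraph "schreier_graph X G act A" by (rule pair_wf_digraph_schreier)
  interpret B: pair_wf_digraph "schreier_graph X G act B" by (rule pair_wf_digraph_schreier)
  let ?T = "A \<union> m_inv G ` A"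
  have T: "finite ?T" "?T \<subseteq> generate G B"
    using A B by (auto simp: generating_set_def)
  have "\<forall>s\<in>?T. \<exists>n. \<forall>x\<in>X. \<exists>p. B.awalk x p (act x s) \<and> length p \<le> n"
    using ex_uniform_awalk_bound[of B] B T(2) by (auto simp: generating_set_def)
  then obtain N where N:
    "\<And>s x. s \<in> ?T \<Longrightarrow> x \<in> X \<Longrightarrow> \<exists>p. B.awalk x p (act x s) \<and> length p \<le> N s"
    by (metis (no_types, lifting))
  \<comment> \<open>This is where finiteness of \<open>A\<close> enters; a sum is a convenient upper bound since it is also
    defined when \<open>A\<close> is empty.\<close>
  define n where "n = sum N ?T"
  have arcs: "\<exists>r. B.awalk u r v \<and> length r \<le> n"
    if "(u, v) \<in> parcs (schreier_graph X G act A)" for u v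
  proof -
    have "u \<in> X" "\<exists>s\<in>?T. v = act u s"
      using that by (simp_all add: schreier_graph_def)
    then obtain s where s: "u \<in> X" "s \<in> ?T" "v = act u s" by blast
    have "N s \<le> n" unfolding n_def using s(2) T(1) by (intro member_le_sum) auto
    then show ?thesis using N[OF s(2,1)] s(3) by (meson le_trans)
  qed
  have "path_dist (schreier_graph X G act B) x (act x g)
      \<le> n * path_dist (schreier_graph X G act A) x (act x g)"
    if xg: "x \<in> X" "g \<in> carrier G" for x g
  proof -
    obtain p where p: "A.awalk x p (act x g)"
      "path_dist (schreier_graph X G act A) x (act x g) = real (length p)"
      using A.ex_shortest_awalk[OF schreier_reachable[OF A(2) xg]] .
    obtain r where r: "B.awalk x r (act x g)" "length r \<le> n * length p"
      using A.awalk_substitute[OF B.pair_wf_digraph_axioms _ arcs p(1)]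
      by (auto simp: pverts_schreier)
    have "path_dist (schreier_graph X G act B) x (act x g) \<le> real (length r)"
      using r(1) by (rule B.path_dist_le_length)
    also have "\<dots> \<le> real (n * length p)" using r(2) by (simp only: of_nat_le_iff)
    finally show ?thesis using p(2) by simp
  qed
  then show ?thesis by blast
qed

lemma quasi_isometry_schreier:
  assumes A: "finite A" "generating_set G A" and B: "finite B" "generating_set G B"
    and C: "C \<subseteq> X"
    and trans: "\<And>x y. x \<in> C \<Longrightarrow> y \<in> C \<Longrightarrow> \<exists>g\<in>carrier G. y = act x g"
  shows "quasi_isometry (path_metric (schreier_graph X G act A) C)
    (path_metric (schreier_graph X G act B) C) (\<lambda>x\<in>C. x)"
proof -
  let ?a = "path_dist (schreier_graph X G act A)" and ?b = "path_dist (schreier_graph X G act B)"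
  interpret A: Metric_space C ?a by (rule Metric_space_schreier[OF A(2) C trans])
  interpret B: Metric_space C ?b by (rule Metric_space_schreier[OF B(2) C trans])
  obtain m :: nat where m: "\<And>x y. x \<in> C \<Longrightarrow> y \<in> C \<Longrightarrow> ?b x y \<le> m * ?a x y"
    using ex_schreier_path_dist_bound[OF A B(2)] trans C by (metis subsetD)
  obtain n :: nat where n: "\<And>x y. x \<in> C \<Longrightarrow> y \<in> C \<Longrightarrow> ?a x y \<le> n * ?b x y"
    using ex_schreier_path_dist_bound[OF B A(2)] trans C by (metis subsetD)
  define K :: real where "K = 1 + real m + real n"
  have K: "K \<ge> 1" "real m \<le> K" "real n \<le> K" by (auto simp: K_def)
  have upper: "?b x y \<le> K * ?a x y" and lower: "?a x y / K \<le> ?b x y" if "x \<in> C" "y \<in> C" for x y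
  proof -
    show "?b x y \<le> K * ?a x y"
      using m[OF that] mult_right_mono[OF K(2) A.nonneg[of x y]] by linarith
    have "?a x y \<le> K * ?b x y"
      using n[OF that] mult_right_mono[OF K(3) B.nonneg[of x y]] by linarith
    then show "?a x y / K \<le> ?b x y" using K(1) by (simp add: divide_le_eq mult.commute)
  qed
  have "(\<forall>z\<in>C. \<exists>x\<in>C. ?b x z \<le> 0)" by (metis B.mdist_zero order_refl)
  then show ?thesis
    unfolding quasi_isometry_def path_metric_def A.mspace_metric B.mspace_metric
      A.mdist_metric B.mdist_metric
    using K(1) upper lower by (intro conjI exI[of _ K] exI[of _ 0]) auto
qed

end


section \<open>The groups of a quandle\<close>

context quandle
begin

abbreviation "Aut \<equiv> quandle_Aut X (\<triangleleft>)"
abbreviation "Inn \<equiv> quandle_Inn X (\<triangleleft>)"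
abbreviation "Dis \<equiv> quandle_Dis X (\<triangleleft>)"
abbreviation "sym_at \<equiv> point_symmetry X (\<triangleleft>)"

lemma inv_into_quandle_hom:
  assumes f: "f \<in> carrier Aut" and xy: "x \<in> X" "y \<in> X"
  shows "inv_into X f (x \<triangleleft> y) = inv_into X f x \<triangleleft> inv_into X f y"
proof -
  have b: "bij_betw f X X" and hom: "\<And>x y. x \<in> X \<Longrightarrow> y \<in> X \<Longrightarrow> f (x \<triangleleft> y) = f x \<triangleleft> f y"
    using f by (auto simp: quandle_Aut_def Bij_def)
  have im: "inv_into X f z \<in> X" "f (inv_into X f z) = z" if "z \<in> X" for z
    using b that by (metis bij_betw_imp_surj_on inv_into_into, metis bij_betw_inv_into_right)
  have "f (inv_into X f x \<triangleleft> inv_into X f y) = x \<triangleleft> y"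
    using xy by (simp add: hom im)
  then show ?thesis
    using bij_betw_inv_into_left[OF b] closed im(1) xy by metis
qed

lemma group_Aut: "group Aut"
proof (rule groupI)
  fix f g assume fg: "f \<in> carrier Aut" "g \<in> carrier Aut"
  then have "f x \<in> X" if "x \<in> X" for x
    using that by (auto simp: quandle_Aut_def dest: Bij_imp_funcset)
  with fg show "f \<otimes>\<^bsub>Aut\<^esub> g \<in> carrier Aut"
    by (auto simp: quandle_Aut_def compose_Bij compose_eq closed)
next
  show "\<one>\<^bsub>Aut\<^esub> \<in> carrier Aut"
    by (auto simp: quandle_Aut_def id_Bij closed)
next
  fix f g h assume "f \<in> carrier Aut" "g \<in> carrier Aut" "h \<in> carrier Aut"
  then show "f \<otimes>\<^bsub>Aut\<^esub> g \<otimes>\<^bsub>Aut\<^esub> h = f \<otimes>\<^bsub>Aut\<^esub> (g \<otimes>\<^bsub>Aut\<^esub> h)"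
    by (auto simp: quandle_Aut_def intro!: compose_assoc[OF Bij_imp_funcset])
next
  fix f assume "f \<in> carrier Aut"
  then show "\<one>\<^bsub>Aut\<^esub> \<otimes>\<^bsub>Aut\<^esub> f = f"
    by (auto simp: quandle_Aut_def intro!: compose_Id[OF Bij_imp_funcset Bij_imp_extensional])
next
  fix f assume f: "f \<in> carrier Aut"
  then have B: "f \<in> Bij X" by (simp add: quandle_Aut_def)
  let ?g = "restrict (inv_into X f) X"
  have "?g \<in> carrier Aut"
    using f inv_into_quandle_hom[OF f]
    by (simp add: quandle_Aut_def restrict_inv_into_Bij closed)
  moreover have "?g \<otimes>\<^bsub>Aut\<^esub> f = \<one>\<^bsub>Aut\<^esub>"
    using B by (auto simp: quandle_Aut_def compose_def Bij_def bij_betw_inv_into_right restrict_def)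
  ultimately show "\<exists>g\<in>carrier Aut. g \<otimes>\<^bsub>Aut\<^esub> f = \<one>\<^bsub>Aut\<^esub>" by blast
qed

sublocale Aut: right_action Aut X "\<lambda>x f. f x"
proof -
  interpret group Aut by (rule group_Aut)
  show "right_action Aut X (\<lambda>x f. f x)"
    by unfold_locales (auto simp: quandle_Aut_def compose_eq dest: Bij_imp_funcset)
qed

lemma right_action_subgroup:
  assumes "subgroup H Aut"
  shows "right_action (Aut\<lparr>carrier := H\<rparr>) X (\<lambda>x f. f x)"
proof -
  interpret group "Aut\<lparr>carrier := H\<rparr>" by (rule Aut.subgroup_imp_group[OF assms])
  show ?thesis
    using subgroup.subset[OF assms]
    by unfold_locales (auto intro: Aut.act_closed simp: Aut.act_one subset_iff Aut.act_mult)
qed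

lemma sym_at_in_Aut:
  assumes "y \<in> X"
  shows "sym_at y \<in> carrier Aut"
proof -
  have "sym_at y \<in> Bij X"
    using bij[OF assms] by (simp add: Bij_def point_symmetry_def cong: bij_betw_cong)
  then show ?thesis
    using assms by (auto simp: quandle_Aut_def point_symmetry_def closed intro: distrib)
qed

lemma Inn_generators: "{sym_at y | y. y \<in> X} \<subseteq> carrier Aut"
  using sym_at_in_Aut by blast

lemma Dis_generators:
  "{sym_at x \<otimes>\<^bsub>Aut\<^esub> inv\<^bsub>Aut\<^esub> (sym_at y) | x y. x \<in> X \<and> y \<in> X} \<subseteq> carrier Aut"
  using sym_at_in_Aut by auto

sublocale Inn: right_action Inn X "\<lambda>x f. f x"
  unfolding quandle_Inn_def
  by (rule right_action_subgroup[OF Aut.generate_is_subgroup[OF Inn_generators]])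

sublocale Dis: right_action Dis X "\<lambda>x f. f x"
  unfolding quandle_Dis_def
  by (rule right_action_subgroup[OF Aut.generate_is_subgroup[OF Dis_generators]])

text \<open>As \<open>s\<^sub>x\<close> fixes \<open>x\<close>, the displacement \<open>s\<^sub>x s\<^sub>y\<inverse>\<close> imitates \<open>s\<^sub>y\<inverse>\<close> at \<open>x\<close>. The imitating
  displacement depends on \<open>x\<close>, so in general \<open>h\<close> agrees with \<open>g\<close> at this one
  point only.\<close>

lemma Dis_orbit_if_Inn:
  assumes "g \<in> carrier Inn" "x \<in> X"
  shows "\<exists>h\<in>carrier Dis. h x = g x"
proof -
  have inv_step: "\<exists>h\<in>carrier Dis. h x = (inv\<^bsub>Aut\<^esub> (sym_at y)) x" if xy: "x \<in> X" "y \<in> X" for x y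
  proof
    let ?h = "sym_at x \<otimes>\<^bsub>Aut\<^esub> inv\<^bsub>Aut\<^esub> (sym_at y)"
    show "?h \<in> carrier Dis"
      unfolding quandle_Dis_def using xy by (simp, intro generate.incl) blast
    show "?h x = (inv\<^bsub>Aut\<^esub> (sym_at y)) x"
      using Aut.act_mult[of x "sym_at x" "inv\<^bsub>Aut\<^esub> (sym_at y)"] xy sym_at_in_Aut
      by (simp add: point_symmetry_def idem)
  qed
  have "g \<in> generate Aut {sym_at y | y. y \<in> X}"
    using assms(1) by (simp add: quandle_Inn_def)
  then show ?thesis
    using assms(2)
  proof (induction arbitrary: x rule: generate.induct)
    case one
    then show ?case
      using Dis.one_closed by (auto simp: quandle_Dis_def)
  next
    case (incl f)
    then obtain y where y: "y \<in> X" "f = sym_at y" by blast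
    let ?z = "sym_at y x"
    have z: "?z \<in> X" using Aut.act_closed[OF incl.prems sym_at_in_Aut[OF y(1)]] .
    \<comment> \<open>This imitates inverses of symmetries only, so it is applied at the end point \<open>s\<^sub>y(x)\<close>,
      and the displacement that leads back to \<open>x\<close> is inverted.\<close>
    obtain h where h: "h \<in> carrier Dis" "h ?z = x"
      using inv_step[OF z y(1)] Aut.act_inv_act[OF incl.prems sym_at_in_Aut[OF y(1)]] by auto
    then show ?case
      using Dis.act_inv_act[OF z h(1)] Dis.inv_closed[OF h(1)] y(2) by auto
  next
    case (inv f)
    then show ?case using inv_step by blast
  next
    case (eng f g)
    obtain h where h: "h \<in> carrier Dis" "h x = f x" using eng.IH(1) eng.prems by blast
    have fg: "f \<in> carrier Aut" "g \<in> carrier Aut"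
      using eng.hyps Aut.generate_in_carrier[OF Inn_generators] by auto
    obtain k where k: "k \<in> carrier Dis" "k (f x) = g (f x)"
      using eng.IH(2)[of "f x"] Aut.act_closed[OF eng.prems fg(1)] by blast
    have "(h \<otimes>\<^bsub>Dis\<^esub> k) x = (f \<otimes>\<^bsub>Aut\<^esub> g) x"
      using h k eng.prems fg by (simp add: Dis.act_mult Aut.act_mult)
    then show ?case using h(1) k(1) Dis.m_closed by blast
  qed
qed

lemma component_subset:
  assumes "C \<in> quandle_components X (\<triangleleft>)"
  shows "C \<subseteq> X"
  using assms Inn.act_closed by (auto simp: quandle_components_def orbits_def orbit_def)

lemma Inn_transitive_on_component:
  assumes "C \<in> quandle_components X (\<triangleleft>)" "x \<in> C" "y \<in> C"
  shows "\<exists>g\<in>carrier Inn. y = g x"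
proof -
  obtain z f g where z: "z \<in> X" and f: "f \<in> carrier Inn" "x = f z" and g: "g \<in> carrier Inn" "y = g z"
    using assms by (auto simp: quandle_components_def orbits_def orbit_def)
  have "(inv\<^bsub>Inn\<^esub> f \<otimes>\<^bsub>Inn\<^esub> g) x = y"
    using z f g by (simp add: Inn.act_mult Inn.act_closed Inn.act_inv_act)
  then show ?thesis using f(1) g(1) by (metis Inn.inv_closed Inn.m_closed)
qed

lemma Dis_transitive_on_component:
  assumes "C \<in> quandle_components X (\<triangleleft>)" "x \<in> C" "y \<in> C"
  shows "\<exists>g\<in>carrier Dis. y = g x"
  using Inn_transitive_on_component[OF assms] Dis_orbit_if_Inn component_subset[OF assms(1)] assms(2)
  by (metis subsetD)

end


section \<open>Independence of the finite generating set\<close>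

theorem theorem1p2:
  fixes X C :: "'a set" and q :: "'a \<Rightarrow> 'a \<Rightarrow> 'a"
  assumes "quandle X q"
    and "C \<in> quandle_components X q"
  shows "(\<forall>A B. finite A \<and> generating_set (quandle_Inn X q) A \<and>
                finite B \<and> generating_set (quandle_Inn X q) B \<longrightarrow>
            quasi_isometry (inner_metric X q A C) (inner_metric X q B C) (\<lambda>x\<in>C. x))
       \<and> (\<forall>U V. finite U \<and> generating_set (quandle_Dis X q) U \<and>
                finite V \<and> generating_set (quandle_Dis X q) V \<longrightarrow>
            quasi_isometry (displacement_metric X q U C) (displacement_metric X q V C) (\<lambda>x\<in>C. x))"
proof -
  interpret quandle X q by (rule assms(1))
  note sub = component_subset[OF assms(2)]
  show ?thesis
    unfolding inner_metric_def displacement_metric_def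
    using Inn.quasi_isometry_schreier[OF _ _ _ _ sub Inn_transitive_on_component[OF assms(2)]]
      Dis.quasi_isometry_schreier[OF _ _ _ _ sub Dis_transitive_on_component[OF assms(2)]]
    by blast
qed

end
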